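(* Let $\emptyset\neq\mathcal{A}\subseteq\mathbb{R}^n$ and $\mathcal{B}\subseteq\mathbb{N}^n\setminus(2\mathbb{N})^n$ be finite sets and let $f\in\mathbb{R}[\mathcal{A},\mathcal{B}]$. If $f\in C_{\mathcal{S}}(\mathcal{A}',\mathcal{B}')$ for some finite sets $\mathcal{A}'$, $\mathcal{B}'$ with $\mathcal{A}\subseteq\mathcal{A}'\subseteq\mathbb{R}^n$ and $\mathcal{B}\subseteq\mathcal{B}'\subseteq\mathbb{N}^n\setminus(2\mathbb{N})^n$, then $f\in C_{\mathcal{S}}(\mathcal{A},\mathcal{B})$ as well. Equivalently, for all such $\mathcal{A}',\mathcal{B}'$, $$C_{\mathcal{S}}(\mathcal{A},\mathcal{B})=C_{\mathcal{S}}(\mathcal{A}',\mathcal{B}')\cap\mathbb{R}[\mathcal{A},\mathcal{B}].$$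
   Context: $\mathbb{N}=\{0,1,2,\ldots\}$. For $x\in\mathbb{R}^n$, $\alpha\in\mathbb{R}^n$, $\beta\in\mathbb{N}^n$ put $|x|^\alpha=\prod_j|x_j|^{\alpha_j}$ and $x^\beta=\prod_j x_j^{\beta_j}$; if a component of $x$ is zero and the corresponding exponent is negative, then $|x|^\alpha=\infty$. For finite sets $\emptyset\neq\mathcal{A}\subseteq\mathbb{R}^n$ and $\mathcal{B}\subseteq\mathbb{N}^n\setminus(2\mathbb{N})^n$ (not necessarily disjoint), $\mathbb{R}[\mathcal{A},\mathcal{B}]$ is the real vector space, of dimension $|\mathcal{A}|+|\mathcal{B}|$, of all functions $f=\sum_{\alpha\in\mathcal{A}}c_\alpha|x|^\alpha+\sum_{\beta\in\mathcal{B}}d_\beta x^\beta$ with real coefficients. Such an $f$ is viewed as a function $\mathbb{R}^n\to\mathbb{R}\cup\{\infty\}$, with value $\infty$ at points where some monomial occurring in $f$ with nonzero coefficient is $\infty$; $f$ is non-negative if $f(x)\ge0$ for all $x\in\mathbb{R}^n$. Such an $f$ is an even AG function if at most one $c_\alpha$ is negative and all $d_\beta$ are zero; it is an odd AG function if all $c_\alpha$ are non-negative and at most one $d_\beta$ is nonzero; it is an AG function if it is an even or an odd AG function. The $\mathcal{S}$-cone $C_{\mathcal{S}}(\mathcal{A},\mathcal{B})$ is the conic hull (set of all finite non-negative linear combinations, including $0$) of the non-negative AG functions in $\mathbb{R}[\mathcal{A},\mathcal{B}]$. *)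

theory Defs
  imports "HOL-Analysis.Analysis"
begin

text \<open>
  \<open>abs_monomial x \<alpha>\<close> is \<open>|x|\<^sup>\<alpha>\<close>. The case \<open>\<alpha> $ j = 0\<close> is treated separately because
  \<open>0 powr 0 = 0\<close> in HOL, whereas here \<open>|0|\<^sup>0 = 1\<close>. A zero component with negative exponent makes
  the whole monomial infinite, even if another factor vanishes.
\<close>

definition abs_monomial :: "real ^ 'n \<Rightarrow> real ^ 'n \<Rightarrow> ereal" where
  "abs_monomial x \<alpha> =
     (if \<exists>j. x $ j = 0 \<and> \<alpha> $ j < 0 then \<infinity>
      else ereal (\<Prod>j\<in>UNIV. if \<alpha> $ j = 0 then 1 else \<bar>x $ j\<bar> powr (\<alpha> $ j)))"

definition monomial :: "real ^ 'n \<Rightarrow> nat ^ 'n \<Rightarrow> real" where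
  "monomial x \<beta> = (\<Prod>j\<in>UNIV. (x $ j) ^ (\<beta> $ j))"

definition even_exponents :: "(nat ^ 'n) set" where
  "even_exponents = {\<beta>. \<forall>j. even (\<beta> $ j)}"

text \<open>
  The function with coefficients \<open>c\<close> (at the \<open>|x|\<^sup>\<alpha>\<close>) and \<open>d\<close> (at the \<open>x\<^sup>\<beta>\<close>), as a function into
  \<open>\<real> \<union> {\<infinity>}\<close>. It is only used for \<open>c\<close>, \<open>d\<close> of finite support. The value is \<open>\<infinity>\<close> as soon as a
  monomial with nonzero coefficient, of whichever sign, is infinite.
\<close>

definition ag_fun :: "(real ^ 'n \<Rightarrow> real) \<Rightarrow> (nat ^ 'n \<Rightarrow> real) \<Rightarrow> real ^ 'n \<Rightarrow> ereal" where
  "ag_fun c d x =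
     (if \<exists>\<alpha>. c \<alpha> \<noteq> 0 \<and> abs_monomial x \<alpha> = \<infinity> then \<infinity>
      else ereal ((\<Sum>\<alpha> | c \<alpha> \<noteq> 0. c \<alpha> * real_of_ereal (abs_monomial x \<alpha>))
                + (\<Sum>\<beta> | d \<beta> \<noteq> 0. d \<beta> * monomial x \<beta>)))"

definition coeffs_in ::
    "(real ^ 'n) set \<Rightarrow> (nat ^ 'n) set \<Rightarrow> (real ^ 'n \<Rightarrow> real) \<Rightarrow> (nat ^ 'n \<Rightarrow> real) \<Rightarrow> bool" where
  "coeffs_in A B c d \<longleftrightarrow> (\<forall>\<alpha>. c \<alpha> \<noteq> 0 \<longrightarrow> \<alpha> \<in> A) \<and> (\<forall>\<beta>. d \<beta> \<noteq> 0 \<longrightarrow> \<beta> \<in> B)"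

text \<open>The space \<open>\<real>[A,B]\<close>.\<close>

definition ag_space :: "(real ^ 'n) set \<Rightarrow> (nat ^ 'n) set \<Rightarrow> (real ^ 'n \<Rightarrow> ereal) set" where
  "ag_space A B = {ag_fun c d | c d. coeffs_in A B c d}"

definition even_AG :: "(real ^ 'n \<Rightarrow> real) \<Rightarrow> (nat ^ 'n \<Rightarrow> real) \<Rightarrow> bool" where
  "even_AG c d \<longleftrightarrow> (\<exists>\<^sub>\<le>\<^sub>1\<alpha>. c \<alpha> < 0) \<and> (\<forall>\<beta>. d \<beta> = 0)"

definition odd_AG :: "(real ^ 'n \<Rightarrow> real) \<Rightarrow> (nat ^ 'n \<Rightarrow> real) \<Rightarrow> bool" where
  "odd_AG c d \<longleftrightarrow> (\<forall>\<alpha>. c \<alpha> \<ge> 0) \<and> (\<exists>\<^sub>\<le>\<^sub>1\<beta>. d \<beta> \<noteq> 0)"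

definition nonneg_AG ::
    "(real ^ 'n) set \<Rightarrow> (nat ^ 'n) set \<Rightarrow> (real ^ 'n \<Rightarrow> real) \<Rightarrow> (nat ^ 'n \<Rightarrow> real) \<Rightarrow> bool" where
  "nonneg_AG A B c d \<longleftrightarrow>
     coeffs_in A B c d \<and> (even_AG c d \<or> odd_AG c d) \<and> (\<forall>x. 0 \<le> ag_fun c d x)"

text \<open>
  The conic hull is formed in the vector space \<open>\<real>[A,B]\<close>, of dimension \<open>|A| + |B|\<close>, so linear
  combinations are taken coefficientwise. Pointwise addition in \<open>\<real> \<union> {\<infinity>}\<close> would differ: when
  coefficients of an infinite monomial cancel, that monomial no longer occurs in the sum.
\<close>

definition S_cone :: "(real ^ 'n) set \<Rightarrow> (nat ^ 'n) set \<Rightarrow> (real ^ 'n \<Rightarrow> ereal) set" where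
  "S_cone A B =
     {ag_fun (\<lambda>\<alpha>. \<Sum>i<m. t i * c i \<alpha>) (\<lambda>\<beta>. \<Sum>i<m. t i * d i \<beta>) | (m::nat) t c d.
        \<forall>i<m. t i \<ge> 0 \<and> nonneg_AG A B (c i) (d i)}"

end

theory Submission
  imports Defs
begin

text \<open>
  Decompose \<open>f\<close> into non-negative AG functions supported on the larger sets \<open>A'\<close> and \<open>B'\<close>; the
  summands may use exponents that cancel in \<open>f\<close>. They can be removed as follows.

  \<^item> An odd exponent outside \<open>B\<close> is simply deleted from every summand. A summand that contains it
    is an odd AG function with no other odd term, so what remains has only non-negative
    coefficients and is still non-negative (\<open>nonneg_AG_restrict_odd\<close>).

  \<^item> Let \<open>a\<close> be an even exponent outside \<open>A\<close>. The summands with a negative coefficient at \<open>a\<close> are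
    even AG functions whose other coefficients are all non-negative; let \<open>g\<close> be their sum. Since
    the coefficients at \<open>a\<close> cancel in total, \<open>g\<close> can be distributed over the remaining summands
    so that each of them loses its term at \<open>a\<close>. Apart from its term at \<open>a\<close>, \<open>g\<close> has only
    non-negative coefficients, so receiving a share of it keeps each summand an AG function
    (\<open>AG_decomposable_remove_even\<close>).

  Two facts make it possible to argue with coefficients. When the term at \<open>a\<close> cancels, a sum can
  become finite at points where its summands were infinite, so non-negativity there does not follow
  by adding values; but an AG function is non-negative as soon as it is so at the points without
  zero coordinates, by a limit argument (\<open>ag_fun_nonneg_iff_nonzero_coords\<close>). And the coefficients
  of \<open>f\<close> outside \<open>A\<close> and \<open>B\<close> really vanish, because the functions \<open>|x|\<^sup>\<alpha>\<close> and \<open>x\<^sup>\<beta>\<close> with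
  \<open>\<beta>\<close> not even are distinct characters of the group of points without zero coordinates, hence
  linearly independent (\<open>ag_fun_coeffs_unique\<close>).
\<close>

section \<open>Values at points without zero coordinates\<close>

definition nonzero_coords :: "(real ^ 'n) set" where
  "nonzero_coords = {x. \<forall>j. x $ j \<noteq> 0}"

text \<open>To be used only where no coordinate of \<open>x\<close> is zero; elsewhere \<open>0 powr 0 = 0\<close> spoils it.\<close>

definition abs_power :: "real ^ 'n \<Rightarrow> real ^ 'n \<Rightarrow> real" where
  "abs_power x \<alpha> = (\<Prod>j\<in>UNIV. \<bar>x $ j\<bar> powr (\<alpha> $ j))"

text \<open>
  Summing over fixed sets \<open>A\<close> and \<open>B\<close> instead of over the supports makes the value linear in the
  coefficients.
\<close>

definition ag_sum ::
    "(real ^ 'n) set \<Rightarrow> (nat ^ 'n) set \<Rightarrow> (real ^ 'n \<Rightarrow> real) \<Rightarrow> (nat ^ 'n \<Rightarrow> real) \<Rightarrow> real ^ 'n \<Rightarrow> real" where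
  "ag_sum A B c d x = (\<Sum>\<alpha>\<in>A. c \<alpha> * abs_power x \<alpha>) + (\<Sum>\<beta>\<in>B. d \<beta> * monomial x \<beta>)"

lemma abs_monomial_nonzero_coords:
  assumes "x \<in> nonzero_coords"
  shows "abs_monomial x \<alpha> = ereal (abs_power x \<alpha>)"
proof -
  have "(if \<alpha> $ j = 0 then 1 else \<bar>x $ j\<bar> powr (\<alpha> $ j)) = \<bar>x $ j\<bar> powr (\<alpha> $ j)" for j
    using assms by (auto simp: nonzero_coords_def)
  then show ?thesis
    using assms by (simp add: abs_monomial_def abs_power_def nonzero_coords_def)
qed

lemma ag_fun_nonzero_coords:
  assumes "x \<in> nonzero_coords" and "finite A" "finite B" and "coeffs_in A B c d"
  shows "ag_fun c d x = ereal (ag_sum A B c d x)"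
proof -
  have "(\<Sum>\<alpha> | c \<alpha> \<noteq> 0. c \<alpha> * abs_power x \<alpha>) = (\<Sum>\<alpha>\<in>A. c \<alpha> * abs_power x \<alpha>)"
    using assms by (intro sum.mono_neutral_left) (auto simp: coeffs_in_def)
  moreover have "(\<Sum>\<beta> | d \<beta> \<noteq> 0. d \<beta> * monomial x \<beta>) = (\<Sum>\<beta>\<in>B. d \<beta> * monomial x \<beta>)"
    using assms by (intro sum.mono_neutral_left) (auto simp: coeffs_in_def)
  ultimately show ?thesis
    by (simp add: ag_fun_def ag_sum_def abs_monomial_nonzero_coords[OF assms(1)])
qed

lemma ag_sum_add_scaled:
  "ag_sum A B (\<lambda>\<alpha>. c \<alpha> + t * c' \<alpha>) (\<lambda>\<beta>. d \<beta> + t * d' \<beta>) x = ag_sum A B c d x + t * ag_sum A B c' d' x"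
  by (simp add: ag_sum_def algebra_simps sum.distrib sum_distrib_left)

lemma ag_sum_scale:
  "ag_sum A B (\<lambda>\<alpha>. t * c \<alpha>) (\<lambda>\<beta>. t * d \<beta>) x = t * ag_sum A B c d x"
  by (simp add: ag_sum_def algebra_simps sum_distrib_left)

lemma ag_sum_sum:
  "ag_sum A B (\<lambda>\<alpha>. \<Sum>i\<in>I. c i \<alpha>) (\<lambda>\<beta>. \<Sum>i\<in>I. d i \<beta>) x = (\<Sum>i\<in>I. ag_sum A B (c i) (d i) x)"
proof -
  have "(\<Sum>\<alpha>\<in>A. (\<Sum>i\<in>I. c i \<alpha>) * abs_power x \<alpha>) = (\<Sum>i\<in>I. \<Sum>\<alpha>\<in>A. c i \<alpha> * abs_power x \<alpha>)"
    unfolding sum_distrib_right by (rule sum.swap)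
  moreover have "(\<Sum>\<beta>\<in>B. (\<Sum>i\<in>I. d i \<beta>) * monomial x \<beta>) = (\<Sum>i\<in>I. \<Sum>\<beta>\<in>B. d i \<beta> * monomial x \<beta>)"
    unfolding sum_distrib_right by (rule sum.swap)
  ultimately show ?thesis
    by (simp add: ag_sum_def sum.distrib)
qed

text \<open>
  A point \<open>x\<close> where the function is finite is the limit of the points obtained by replacing its
  zero coordinates by some \<open>\<epsilon> > 0\<close>. Every monomial that occurs has exponent \<open>\<ge> 0\<close> in those
  coordinates, and so is continuous along this path.
\<close>

lemma ag_fun_nonneg_iff_nonzero_coords:
  assumes "finite A" "finite B" and supp: "coeffs_in A B c d"
  shows "(\<forall>x. 0 \<le> ag_fun c d x) \<longleftrightarrow> (\<forall>x\<in>nonzero_coords. 0 \<le> ag_sum A B c d x)"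
proof
  assume "\<forall>x. 0 \<le> ag_fun c d x"
  then show "\<forall>x\<in>nonzero_coords. 0 \<le> ag_sum A B c d x"
    using ag_fun_nonzero_coords[OF _ assms] by (metis ereal_less_eq(5))
next
  assume nonneg: "\<forall>x\<in>nonzero_coords. 0 \<le> ag_sum A B c d x"
  show "\<forall>x. 0 \<le> ag_fun c d x"
  proof
    fix x :: "real ^ 'a"
    show "0 \<le> ag_fun c d x"
    proof (cases "\<exists>\<alpha>. c \<alpha> \<noteq> 0 \<and> abs_monomial x \<alpha> = \<infinity>")
      case True
      then show ?thesis by (simp add: ag_fun_def)
    next
      case False
      define y where "y \<epsilon> = (\<chi> j. if x $ j = 0 then \<epsilon> else x $ j)" for \<epsilon> :: real
      have y_nth: "y \<epsilon> $ j = (if x $ j = 0 then \<epsilon> else x $ j)" for \<epsilon> j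
        by (simp add: y_def)
      have ev: "\<forall>\<^sub>F \<epsilon> in at_right 0. (0::real) < \<epsilon>"
        by (simp add: eventually_at_right_less)
      have lim_even: "((\<lambda>\<epsilon>. abs_power (y \<epsilon>) \<alpha>) \<longlongrightarrow> real_of_ereal (abs_monomial x \<alpha>)) (at_right 0)"
        if "c \<alpha> \<noteq> 0" for \<alpha>
      proof -
        have fin: "\<not> (\<exists>j. x $ j = 0 \<and> \<alpha> $ j < 0)"
        proof -
          have "abs_monomial x \<alpha> \<noteq> \<infinity>"
            using False that by blast
          then show ?thesis
            by (auto simp: abs_monomial_def split: if_splits)
        qed
        have "((\<lambda>\<epsilon>. \<bar>y \<epsilon> $ j\<bar> powr (\<alpha> $ j))
                \<longlongrightarrow> (if \<alpha> $ j = 0 then 1 else \<bar>x $ j\<bar> powr (\<alpha> $ j))) (at_right 0)" for j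
        proof (cases "x $ j = 0 \<and> \<alpha> $ j \<noteq> 0")
          case True
          with fin have "\<alpha> $ j > 0"
            by (metis not_less_iff_gr_or_eq)
          have "((\<lambda>\<epsilon>::real. \<bar>\<epsilon>\<bar> powr (\<alpha> $ j)) \<longlongrightarrow> \<bar>0\<bar> powr (\<alpha> $ j)) (at_right 0)"
            using \<open>\<alpha> $ j > 0\<close>
            by (intro tendsto_powr2 tendsto_rabs tendsto_ident_at tendsto_const) auto
          then show ?thesis
            using True by (simp add: y_nth)
        next
          case False
          have "\<forall>\<^sub>F \<epsilon> in at_right 0. \<bar>y \<epsilon> $ j\<bar> powr (\<alpha> $ j)
                  = (if \<alpha> $ j = 0 then 1 else \<bar>x $ j\<bar> powr (\<alpha> $ j))"
            using ev by eventually_elim (use False in \<open>auto simp: y_nth\<close>)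
          then show ?thesis
            by (rule tendsto_eventually)
        qed
        then show ?thesis
          using fin by (auto simp: abs_power_def abs_monomial_def intro!: tendsto_prod)
      qed
      have "((\<lambda>\<epsilon>. y \<epsilon> $ j) \<longlongrightarrow> x $ j) (at_right 0)" for j
        by (cases "x $ j = 0") (simp_all add: y_nth)
      then have lim_odd: "((\<lambda>\<epsilon>. monomial (y \<epsilon>) \<beta>) \<longlongrightarrow> monomial x \<beta>) (at_right 0)" for \<beta>
        unfolding monomial_def by (intro tendsto_prod tendsto_power)
      define v where "v = (\<Sum>\<alpha>\<in>A. c \<alpha> * real_of_ereal (abs_monomial x \<alpha>)) + (\<Sum>\<beta>\<in>B. d \<beta> * monomial x \<beta>)"
      have lim_term: "((\<lambda>\<epsilon>. c \<alpha> * abs_power (y \<epsilon>) \<alpha>) \<longlongrightarrow> c \<alpha> * real_of_ereal (abs_monomial x \<alpha>)) (at_right 0)"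
        for \<alpha>
        by (cases "c \<alpha> = 0") (auto intro!: tendsto_mult lim_even)
      have "((\<lambda>\<epsilon>. ag_sum A B c d (y \<epsilon>)) \<longlongrightarrow> v) (at_right 0)"
        unfolding ag_sum_def v_def
        by (intro tendsto_add tendsto_sum lim_term tendsto_mult_left lim_odd)
      moreover have "\<forall>\<^sub>F \<epsilon> in at_right 0. 0 \<le> ag_sum A B c d (y \<epsilon>)"
        using ev by eventually_elim (use nonneg in \<open>auto simp: nonzero_coords_def y_nth\<close>)
      ultimately have "0 \<le> v"
        by (intro tendsto_lowerbound) auto
      moreover have "(\<Sum>\<alpha> | c \<alpha> \<noteq> 0. c \<alpha> * real_of_ereal (abs_monomial x \<alpha>))
          = (\<Sum>\<alpha>\<in>A. c \<alpha> * real_of_ereal (abs_monomial x \<alpha>))"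
        using assms by (intro sum.mono_neutral_left) (auto simp: coeffs_in_def)
      moreover have "(\<Sum>\<beta> | d \<beta> \<noteq> 0. d \<beta> * monomial x \<beta>) = (\<Sum>\<beta>\<in>B. d \<beta> * monomial x \<beta>)"
        using assms by (intro sum.mono_neutral_left) (auto simp: coeffs_in_def)
      ultimately show ?thesis
        using False by (simp add: ag_fun_def v_def)
    qed
  qed
qed

lemma nonneg_AG_iff_nonzero_coords:
  assumes "finite A" "finite B"
  shows "nonneg_AG A B c d \<longleftrightarrow> coeffs_in A B c d \<and> (even_AG c d \<or> odd_AG c d) \<and>
           (\<forall>x\<in>nonzero_coords. 0 \<le> ag_sum A B c d x)"
  by (simp add: nonneg_AG_def ag_fun_nonneg_iff_nonzero_coords[OF assms] cong: conj_cong)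

section \<open>Uniqueness of the coefficients\<close>

text \<open>
  Dedekind's independence of characters. Evaluating a relation at \<open>mul y x\<close> and subtracting
  \<open>\<phi> i y\<close> times the relation at \<open>x\<close> removes the term of \<open>i\<close>; by induction the coefficients
  \<open>a k * (\<phi> k y - \<phi> i y)\<close> of the shorter relation vanish, and some \<open>y\<close> separates \<open>\<phi> k\<close> from
  \<open>\<phi> i\<close>.
\<close>

lemma characters_independent:
  fixes \<phi> :: "'i \<Rightarrow> 'g \<Rightarrow> 'k::field" and mul :: "'g \<Rightarrow> 'g \<Rightarrow> 'g"
  assumes "finite I"
    and closed: "\<And>x y. x \<in> G \<Longrightarrow> y \<in> G \<Longrightarrow> mul x y \<in> G"
    and e: "e \<in> G"
    and hom: "\<And>i x y. i \<in> I \<Longrightarrow> x \<in> G \<Longrightarrow> y \<in> G \<Longrightarrow> \<phi> i (mul x y) = \<phi> i x * \<phi> i y"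
    and one: "\<And>i. i \<in> I \<Longrightarrow> \<phi> i e = 1"
    and distinct: "\<And>i k. i \<in> I \<Longrightarrow> k \<in> I \<Longrightarrow> i \<noteq> k \<Longrightarrow> \<exists>y\<in>G. \<phi> i y \<noteq> \<phi> k y"
    and "\<And>x. x \<in> G \<Longrightarrow> (\<Sum>i\<in>I. a i * \<phi> i x) = 0"
    and "k \<in> I"
  shows "a k = 0"
  using assms(1) hom one distinct assms(7,8)
proof (induction I arbitrary: a k rule: finite_induct)
  case empty
  then show ?case by simp
next
  case (insert i I)
  have rel: "a i * \<phi> i x + (\<Sum>k\<in>I. a k * \<phi> k x) = 0" if "x \<in> G" for x
    using insert.prems(4)[OF that] insert.hyps by simp
  have zero: "a k = 0" if k: "k \<in> I" for k
  proof -
    have "i \<noteq> k" using insert.hyps k by auto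
    then obtain y where y: "y \<in> G" "\<phi> i y \<noteq> \<phi> k y"
      using insert.prems(3)[of i k] k by auto
    have short: "(\<Sum>k\<in>I. (a k * (\<phi> k y - \<phi> i y)) * \<phi> k x) = 0" if x: "x \<in> G" for x
    proof -
      have "(\<Sum>k\<in>I. (a k * (\<phi> k y - \<phi> i y)) * \<phi> k x)
          = (\<Sum>k\<in>I. a k * \<phi> k (mul y x)) - \<phi> i y * (\<Sum>k\<in>I. a k * \<phi> k x)"
        using insert.prems(1) x y
        by (simp add: sum_distrib_left sum_subtractf[symmetric] algebra_simps)
      also have "\<dots> = (a i * \<phi> i (mul y x) + (\<Sum>k\<in>I. a k * \<phi> k (mul y x)))
          - \<phi> i y * (a i * \<phi> i x + (\<Sum>k\<in>I. a k * \<phi> k x))"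
        using insert.prems(1)[of i y x] x y by (simp add: algebra_simps)
      also have "\<dots> = 0"
        using rel[OF x] rel[OF closed[OF y(1) x]] by simp
      finally show ?thesis .
    qed
    have "a k * (\<phi> k y - \<phi> i y) = 0"
      by (rule insert.IH[where a = "\<lambda>k. a k * (\<phi> k y - \<phi> i y)"])
        (use insert.prems(1-3) short k in auto)
    then show ?thesis using y by simp
  qed
  moreover have "a i = 0"
    using rel[OF e] zero insert.prems(2)[of i] by simp
  ultimately show ?case
    using insert.prems(5) by auto
qed

lemma abs_power_mult: "abs_power (\<chi> j. x $ j * y $ j) \<alpha> = abs_power x \<alpha> * abs_power y \<alpha>"
  by (simp add: abs_power_def abs_mult powr_mult prod.distrib)

lemma monomial_mult: "monomial (\<chi> j. x $ j * y $ j) \<beta> = monomial x \<beta> * monomial y \<beta>"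
  by (simp add: monomial_def power_mult_distrib prod.distrib)

definition coord_point :: "'n \<Rightarrow> real \<Rightarrow> real ^ 'n" where
  "coord_point k t = (\<chi> j. if j = k then t else 1)"

lemma coord_point_nonzero_coords: "t \<noteq> 0 \<Longrightarrow> coord_point k t \<in> nonzero_coords"
  by (simp add: coord_point_def nonzero_coords_def)

lemma abs_power_coord_point:
  fixes k :: "'n::finite"
  shows "abs_power (coord_point k t) \<alpha> = \<bar>t\<bar> powr (\<alpha> $ k)"
proof -
  have "abs_power (coord_point k t) \<alpha> = (\<Prod>j\<in>UNIV. if j = k then \<bar>t\<bar> powr (\<alpha> $ j) else 1)"
    unfolding abs_power_def by (rule prod.cong) (auto simp: coord_point_def)
  then show ?thesis by simp
qed

lemma monomial_coord_point:
  fixes k :: "'n::finite"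
  shows "monomial (coord_point k t) \<beta> = t ^ (\<beta> $ k)"
proof -
  have "monomial (coord_point k t) \<beta> = (\<Prod>j\<in>UNIV. if j = k then t ^ (\<beta> $ j) else 1)"
    unfolding monomial_def by (rule prod.cong) (auto simp: coord_point_def)
  then show ?thesis by simp
qed

text \<open>
  Each monomial is a character. The value \<open>2\<close> in a single coordinate reads off an exponent, and
  the value \<open>-1\<close> in a coordinate with odd exponent tells \<open>x\<^sup>\<beta>\<close> from every \<open>|x|\<^sup>\<alpha>\<close>; this is why
  \<open>B\<close> must avoid the even exponents.
\<close>

lemma ag_sum_eq_0_imp_coeffs_eq_0:
  fixes A :: "(real ^ 'n) set" and B :: "(nat ^ 'n) set"
  assumes "finite A" "finite B" and odd: "B \<inter> even_exponents = {}"
    and zero: "\<And>x. x \<in> nonzero_coords \<Longrightarrow> ag_sum A B c d x = 0"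
  shows "\<alpha> \<in> A \<Longrightarrow> c \<alpha> = 0" and "\<beta> \<in> B \<Longrightarrow> d \<beta> = 0"
proof -
  define \<phi> where "\<phi> = case_sum (\<lambda>\<alpha> (x :: real ^ 'n). abs_power x \<alpha>) (\<lambda>\<beta> x. monomial x \<beta>)"
  have sep_even: "\<exists>y\<in>nonzero_coords. abs_power y \<alpha> \<noteq> abs_power y \<alpha>'" if "\<alpha> \<noteq> \<alpha>'" for \<alpha> \<alpha>' :: "real ^ 'n"
  proof -
    from that obtain k where "\<alpha> $ k \<noteq> \<alpha>' $ k" by (auto simp: vec_eq_iff)
    then show ?thesis
      by (intro bexI[of _ "coord_point k 2"])
        (auto simp: abs_power_coord_point coord_point_nonzero_coords powr_inj)
  qed
  have sep_odd: "\<exists>y\<in>nonzero_coords. monomial y \<beta> \<noteq> monomial y \<beta>'" if "\<beta> \<noteq> \<beta>'" for \<beta> \<beta>' :: "nat ^ 'n"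
  proof -
    from that obtain k where "\<beta> $ k \<noteq> \<beta>' $ k" by (auto simp: vec_eq_iff)
    then show ?thesis
      by (intro bexI[of _ "coord_point k 2"])
        (auto simp: monomial_coord_point coord_point_nonzero_coords)
  qed
  have sep_mixed: "\<exists>y\<in>nonzero_coords. abs_power y \<alpha> \<noteq> monomial y \<beta>" if "\<beta> \<in> B" for \<alpha> \<beta>
  proof -
    from that odd obtain k where "\<not> even (\<beta> $ k)" by (auto simp: even_exponents_def)
    then show ?thesis
      by (intro bexI[of _ "coord_point k (-1)"])
        (auto simp: abs_power_coord_point monomial_coord_point coord_point_nonzero_coords)
  qed
  have coeffs: "case_sum c d i = 0" if "i \<in> A <+> B" for i
  proof (rule characters_independent[where I = "A <+> B" and \<phi> = \<phi> and G = nonzero_coords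
          and mul = "\<lambda>x y. \<chi> j. x $ j * y $ j" and e = "\<chi> j. 1" and a = "case_sum c d"])
    show "\<exists>y\<in>nonzero_coords. \<phi> i y \<noteq> \<phi> k y" if "i \<in> A <+> B" "k \<in> A <+> B" "i \<noteq> k" for i k
      using that sep_even sep_odd sep_mixed
      by (auto simp: \<phi>_def) (metis sep_mixed)+
    show "(\<Sum>i\<in>A <+> B. case_sum c d i * \<phi> i x) = 0" if "x \<in> nonzero_coords" for x
      using zero[OF that] assms(1,2) by (simp add: sum.Plus \<phi>_def ag_sum_def)
    show "\<phi> i (\<chi> j. x $ j * y $ j) = \<phi> i x * \<phi> i y" for i x y
      by (cases i) (simp_all add: \<phi>_def abs_power_mult monomial_mult)
    show "\<phi> i (\<chi> j. 1) = 1" for i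
      by (cases i) (simp_all add: \<phi>_def abs_power_def monomial_def)
  qed (use assms(1,2) that in \<open>auto simp: nonzero_coords_def\<close>)
  show "\<alpha> \<in> A \<Longrightarrow> c \<alpha> = 0" and "\<beta> \<in> B \<Longrightarrow> d \<beta> = 0"
    using coeffs[of "Inl \<alpha>"] coeffs[of "Inr \<beta>"] by auto
qed

lemma ag_fun_coeffs_unique:
  assumes "finite A" "finite B" "B \<inter> even_exponents = {}"
    and supp: "coeffs_in A B c d" "coeffs_in A B c' d'"
    and eq: "ag_fun c d = ag_fun c' d'"
  shows "c = c'" "d = d'"
proof -
  have "ag_sum A B (\<lambda>\<alpha>. c \<alpha> + -1 * c' \<alpha>) (\<lambda>\<beta>. d \<beta> + -1 * d' \<beta>) x = 0"
    if "x \<in> nonzero_coords" for x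
    using ag_fun_nonzero_coords[OF that assms(1,2) supp(1)]
      ag_fun_nonzero_coords[OF that assms(1,2) supp(2)] eq
    unfolding ag_sum_add_scaled by simp
  note coeffs = ag_sum_eq_0_imp_coeffs_eq_0[OF assms(1-3) this]
  show "c = c'"
  proof
    show "c \<alpha> = c' \<alpha>" for \<alpha>
      using coeffs(1)[of \<alpha>] supp unfolding coeffs_in_def by (cases "\<alpha> \<in> A") (simp, metis)
  qed
  show "d = d'"
  proof
    show "d \<beta> = d' \<beta>" for \<beta>
      using coeffs(2)[of \<beta>] supp unfolding coeffs_in_def by (cases "\<beta> \<in> B") (simp, metis)
  qed
qed

section \<open>Decompositions into AG functions\<close>

text \<open>
  The S-cone as a set of coefficient families. The weights of a conic combination are absorbed by
  the summands.
\<close>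

definition AG_decomposable ::
    "(real ^ 'n) set \<Rightarrow> (nat ^ 'n) set \<Rightarrow> (real ^ 'n \<Rightarrow> real) \<Rightarrow> (nat ^ 'n \<Rightarrow> real) \<Rightarrow> bool" where
  "AG_decomposable A B c d \<longleftrightarrow>
     (\<exists>(m::nat) C D. (\<forall>i<m. nonneg_AG A B (C i) (D i)) \<and>
        c = (\<lambda>\<alpha>. \<Sum>i<m. C i \<alpha>) \<and> d = (\<lambda>\<beta>. \<Sum>i<m. D i \<beta>))"

lemma AG_decomposableE:
  assumes "AG_decomposable A B c d"
  obtains m :: nat and C D where "\<forall>i<m. nonneg_AG A B (C i) (D i)"
    and "c = (\<lambda>\<alpha>. \<Sum>i<m. C i \<alpha>)" and "d = (\<lambda>\<beta>. \<Sum>i<m. D i \<beta>)"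
  using assms unfolding AG_decomposable_def by (elim exE conjE) (rule that)

lemma AG_decomposableI:
  fixes m :: nat
  assumes "\<And>i. i < m \<Longrightarrow> nonneg_AG A B (C i) (D i)"
    and "c = (\<lambda>\<alpha>. \<Sum>i<m. C i \<alpha>)" and "d = (\<lambda>\<beta>. \<Sum>i<m. D i \<beta>)"
  shows "AG_decomposable A B c d"
  unfolding AG_decomposable_def
  by (rule exI[of _ m], rule exI[of _ C], rule exI[of _ D]) (use assms in simp)

lemma nonneg_AG_scale:
  assumes "finite A" "finite B" and "nonneg_AG A B c d" and "t \<ge> 0"
  shows "nonneg_AG A B (\<lambda>\<alpha>. t * c \<alpha>) (\<lambda>\<beta>. t * d \<beta>)"
proof -
  have neg: "z < 0" if "t * z < 0" for z :: real
    using that assms(4) by (simp add: mult_less_0_iff)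
  have "coeffs_in A B (\<lambda>\<alpha>. t * c \<alpha>) (\<lambda>\<beta>. t * d \<beta>)"
    using assms(3) by (auto simp: nonneg_AG_def coeffs_in_def)
  moreover have "even_AG (\<lambda>\<alpha>. t * c \<alpha>) (\<lambda>\<beta>. t * d \<beta>)" if "even_AG c d"
    using that neg unfolding even_AG_def Uniq_def by (metis mult_zero_right)
  moreover have "odd_AG (\<lambda>\<alpha>. t * c \<alpha>) (\<lambda>\<beta>. t * d \<beta>)" if "odd_AG c d"
    using that assms(4) unfolding odd_AG_def Uniq_def by (metis mult_nonneg_nonneg mult_zero_right)
  moreover have "0 \<le> ag_sum A B (\<lambda>\<alpha>. t * c \<alpha>) (\<lambda>\<beta>. t * d \<beta>) x" if "x \<in> nonzero_coords" for x
    using assms(3,4) that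
    unfolding ag_sum_scale nonneg_AG_iff_nonzero_coords[OF assms(1,2)] by simp
  ultimately show ?thesis
    using assms(3) unfolding nonneg_AG_iff_nonzero_coords[OF assms(1,2)] by blast
qed

lemma S_cone_iff_AG_decomposable:
  assumes "finite A" "finite B"
  shows "f \<in> S_cone A B \<longleftrightarrow> (\<exists>c d. AG_decomposable A B c d \<and> f = ag_fun c d)"
proof
  assume "f \<in> S_cone A B"
  then obtain m :: nat and t c d
    where f: "f = ag_fun (\<lambda>\<alpha>. \<Sum>i<m. t i * c i \<alpha>) (\<lambda>\<beta>. \<Sum>i<m. t i * d i \<beta>)"
      and nn: "\<forall>i<m. t i \<ge> 0 \<and> nonneg_AG A B (c i) (d i)"
    unfolding S_cone_def mem_Collect_eq by (elim exE conjE) (rule that)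
  have "AG_decomposable A B (\<lambda>\<alpha>. \<Sum>i<m. t i * c i \<alpha>) (\<lambda>\<beta>. \<Sum>i<m. t i * d i \<beta>)"
    by (rule AG_decomposableI[where C = "\<lambda>i \<alpha>. t i * c i \<alpha>" and D = "\<lambda>i \<beta>. t i * d i \<beta>"])
      (simp_all add: nn nonneg_AG_scale[OF assms])
  with f show "\<exists>c d. AG_decomposable A B c d \<and> f = ag_fun c d" by (intro exI conjI)
next
  assume "\<exists>c d. AG_decomposable A B c d \<and> f = ag_fun c d"
  then obtain c d where dec: "AG_decomposable A B c d" and f: "f = ag_fun c d" by blast
  from dec obtain m :: nat and C D where "\<forall>i<m. nonneg_AG A B (C i) (D i)"
      and "c = (\<lambda>\<alpha>. \<Sum>i<m. C i \<alpha>)" "d = (\<lambda>\<beta>. \<Sum>i<m. D i \<beta>)"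
    by (rule AG_decomposableE)
  with f show "f \<in> S_cone A B"
    unfolding S_cone_def mem_Collect_eq
    by - (rule exI[of _ m], rule exI[of _ "\<lambda>i. 1"], rule exI[of _ C], rule exI[of _ D], simp)
qed

lemma AG_decomposable_coeffs_in:
  assumes "AG_decomposable A B c d"
  shows "coeffs_in A B c d"
proof -
  from assms obtain m :: nat and C D
    where nn: "\<forall>i<m. nonneg_AG A B (C i) (D i)"
      and c: "c = (\<lambda>\<alpha>. \<Sum>i<m. C i \<alpha>)" and d: "d = (\<lambda>\<beta>. \<Sum>i<m. D i \<beta>)"
    by (rule AG_decomposableE)
  have supp: "coeffs_in A B (C i) (D i)" if "i < m" for i
    using nn that by (auto simp: nonneg_AG_def)
  have "c \<alpha> = 0" if "\<alpha> \<notin> A" for \<alpha>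
    unfolding c using supp that by (intro sum.neutral) (auto simp: coeffs_in_def)
  moreover have "d \<beta> = 0" if "\<beta> \<notin> B" for \<beta>
    unfolding d using supp that by (intro sum.neutral) (auto simp: coeffs_in_def)
  ultimately show ?thesis
    unfolding coeffs_in_def by blast
qed

lemma AG_decomposable_mono:
  assumes "AG_decomposable A B c d" "A \<subseteq> A'" "B \<subseteq> B'"
  shows "AG_decomposable A' B' c d"
proof -
  have "nonneg_AG A' B' c d" if "nonneg_AG A B c d" for c d
    using that assms(2,3) by (auto simp: nonneg_AG_def coeffs_in_def)
  with assms(1) show ?thesis
    by (elim AG_decomposableE) (rule AG_decomposableI, auto)
qed

section \<open>Removing exponents from a decomposition\<close>

text \<open>
  If an odd term outside \<open>B\<close> occurs, it is the only odd term and \<open>c\<close> has no negative coefficient,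
  so only a sum of non-negative monomials remains.
\<close>

lemma nonneg_AG_restrict_odd:
  assumes "finite A" "finite B'" "B \<subseteq> B'" and nn: "nonneg_AG A B' c d"
  shows "nonneg_AG A B c (\<lambda>\<beta>. if \<beta> \<in> B then d \<beta> else 0)"
proof (cases "\<forall>\<beta>. \<beta> \<notin> B \<longrightarrow> d \<beta> = 0")
  case True
  then have "(\<lambda>\<beta>. if \<beta> \<in> B then d \<beta> else 0) = d" by auto
  with True nn show ?thesis
    by (auto simp: nonneg_AG_def coeffs_in_def)
next
  case False
  then obtain \<beta> where \<beta>: "\<beta> \<notin> B" "d \<beta> \<noteq> 0" by auto
  with nn have c: "\<forall>\<alpha>. c \<alpha> \<ge> 0" and "\<exists>\<^sub>\<le>\<^sub>1\<beta>. d \<beta> \<noteq> 0"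
    by (auto simp: nonneg_AG_def even_AG_def odd_AG_def)
  with \<beta> have d: "(\<lambda>\<beta>. if \<beta> \<in> B then d \<beta> else 0) = (\<lambda>\<beta>. 0)"
    unfolding Uniq_def by (metis (full_types))
  have "finite B" using assms(2,3) finite_subset by blast
  have "0 \<le> ag_sum A B c (\<lambda>\<beta>. 0) x" for x
    using c by (auto simp: ag_sum_def abs_power_def intro!: sum_nonneg mult_nonneg_nonneg prod_nonneg)
  then show ?thesis
    using c nn unfolding d nonneg_AG_iff_nonzero_coords[OF assms(1) \<open>finite B\<close>]
    by (simp add: nonneg_AG_def coeffs_in_def odd_AG_def Uniq_def)
qed

lemma AG_decomposable_restrict_odd:
  assumes "finite A" "finite B'" "B \<subseteq> B'" and "AG_decomposable A B' c d"
    and "\<And>\<beta>. \<beta> \<notin> B \<Longrightarrow> d \<beta> = 0"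
  shows "AG_decomposable A B c d"
proof -
  from assms(4) obtain m :: nat and C D
    where nn: "\<forall>i<m. nonneg_AG A B' (C i) (D i)"
      and c: "c = (\<lambda>\<alpha>. \<Sum>i<m. C i \<alpha>)" and d: "d = (\<lambda>\<beta>. \<Sum>i<m. D i \<beta>)"
    by (rule AG_decomposableE)
  have "d = (\<lambda>\<beta>. \<Sum>i<m. if \<beta> \<in> B then D i \<beta> else 0)"
  proof
    show "d \<beta> = (\<Sum>i<m. if \<beta> \<in> B then D i \<beta> else 0)" for \<beta>
      using assms(5)[of \<beta>] by (cases "\<beta> \<in> B") (simp_all add: d)
  qed
  with nn c show ?thesis
    by (intro AG_decomposableI[where C = C and D = "\<lambda>i \<beta>. if \<beta> \<in> B then D i \<beta> else 0" and m = m]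
        nonneg_AG_restrict_odd[OF assms(1-3)]) simp_all
qed

text \<open>
  With \<open>s\<close> the total of the non-negative coefficients at \<open>a\<close>, the total of the negative ones is
  \<open>-s\<close>. A summand whose coefficient at \<open>a\<close> is \<open>r \<ge> 0\<close> receives the share \<open>r / s\<close> of \<open>g\<close>, which
  has coefficient \<open>-s\<close> there; the shares add up to \<open>1\<close>. If \<open>s = 0\<close>, then \<open>g = 0\<close> and the
  convention \<open>r / 0 = 0\<close> leaves the decomposition as it is.
\<close>

lemma AG_decomposable_remove_even:
  assumes "finite A" "finite B" and dec: "AG_decomposable A B c d" and "c a = 0"
  shows "AG_decomposable (A - {a}) B c d"
proof -
  from dec obtain m :: nat and C D
    where nn_all: "\<forall>i<m. nonneg_AG A B (C i) (D i)"
      and c: "c = (\<lambda>\<alpha>. \<Sum>i<m. C i \<alpha>)" and d: "d = (\<lambda>\<beta>. \<Sum>i<m. D i \<beta>)"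
    by (rule AG_decomposableE)
  from nn_all have nn: "\<And>i. i < m \<Longrightarrow> nonneg_AG A B (C i) (D i)" by blast
  define N where "N = {i. i < m \<and> C i a < 0}"
  define P where "P = {i. i < m \<and> C i a \<ge> 0}"
  have fin: "finite N" "finite P" and un: "{..<m} = N \<union> P" and disj: "N \<inter> P = {}"
    by (auto simp: N_def P_def)
  have split: "(\<Sum>i<m. h i) = (\<Sum>i\<in>N. h i) + (\<Sum>i\<in>P. h i)" for h :: "nat \<Rightarrow> real"
    unfolding un using fin disj by (rule sum.union_disjoint)
  define g where "g \<alpha> = (\<Sum>i\<in>N. C i \<alpha>)" for \<alpha>
  define s where "s = (\<Sum>i\<in>P. C i a)"
  have g_a: "g a = - s"
    using \<open>c a = 0\<close> split[of "\<lambda>i. C i a"] by (simp add: c g_def s_def)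
  \<comment> \<open>Odd AG functions have no negative even coefficient, so the summands in \<open>N\<close> are even ones.\<close>
  have N: "D i = (\<lambda>\<beta>. 0)" "\<And>\<alpha>. \<alpha> \<noteq> a \<Longrightarrow> C i \<alpha> \<ge> 0" if "i \<in> N" for i
  proof -
    have neg: "C i a < 0" and "even_AG (C i) (D i)"
      using that nn[of i] by (auto simp: N_def nonneg_AG_def odd_AG_def not_le[symmetric])
    then show "D i = (\<lambda>\<beta>. 0)" "\<And>\<alpha>. \<alpha> \<noteq> a \<Longrightarrow> C i \<alpha> \<ge> 0"
      unfolding even_AG_def Uniq_def by (auto simp: not_less[symmetric])
  qed
  have g_nonneg: "g \<alpha> \<ge> 0" if "\<alpha> \<noteq> a" for \<alpha>
    unfolding g_def using N(2) that by (auto intro: sum_nonneg)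
  have "g \<alpha> = 0" if "\<alpha> \<notin> A" for \<alpha>
    unfolding g_def using nn that
    by (intro sum.neutral) (auto simp: N_def nonneg_AG_def coeffs_in_def)
  then have g_supp: "g \<alpha> \<noteq> 0 \<Longrightarrow> \<alpha> \<in> A" for \<alpha>
    by blast
  have g_sum: "0 \<le> ag_sum A B g (\<lambda>\<beta>. 0) x" if "x \<in> nonzero_coords" for x
  proof -
    have "ag_sum A B g (\<lambda>\<beta>. 0) x = (\<Sum>i\<in>N. ag_sum A B (C i) (\<lambda>\<beta>. 0) x)"
      using ag_sum_sum[of A B C N "\<lambda>i \<beta>. 0" x] by (simp add: g_def[abs_def])
    also have "\<dots> = (\<Sum>i\<in>N. ag_sum A B (C i) (D i) x)"
      using N(1) by simp
    also have "\<dots> \<ge> 0"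
      using nn that by (intro sum_nonneg) (auto simp: N_def nonneg_AG_iff_nonzero_coords[OF assms(1,2)])
    finally show ?thesis .
  qed
  have s_zero: "N = {}" "\<And>i. i \<in> P \<Longrightarrow> C i a = 0" if "s = 0"
  proof -
    show "N = {}"
    proof (rule ccontr)
      assume "N \<noteq> {}"
      with fin(1) have "(\<Sum>i\<in>N. C i a) < (\<Sum>i\<in>N. 0)"
        by (rule sum_strict_mono) (simp add: N_def)
      then have "g a < 0"
        by (simp add: g_def)
      with g_a that show False by simp
    qed
    have "(\<Sum>i\<in>P. C i a) = 0"
      using that by (simp only: s_def)
    then show "\<And>i. i \<in> P \<Longrightarrow> C i a = 0"
      by (rule sum_nonneg_0[OF fin(2), rotated]) (simp_all add: P_def)
  qed
  have s_nonneg: "s \<ge> 0"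
    unfolding s_def by (rule sum_nonneg) (simp add: P_def)
  define C' where "C' i \<alpha> = (if i \<in> P then C i \<alpha> + C i a / s * g \<alpha> else 0)" for i \<alpha>
  define D' where "D' i \<beta> = (if i \<in> P then D i \<beta> else 0)" for i \<beta>
  have "nonneg_AG (A - {a}) B (C' i) (D' i)" if "i < m" for i
  proof (cases "i \<in> P")
    case False
    then have "C' i = (\<lambda>\<alpha>. 0)" "D' i = (\<lambda>\<beta>. 0)"
      by (auto simp: C'_def D'_def)
    then show ?thesis
      by (simp add: nonneg_AG_def coeffs_in_def even_AG_def ag_fun_def Uniq_def)
  next
    case True
    have C': "C' i = (\<lambda>\<alpha>. C i \<alpha> + C i a / s * g \<alpha>)" and D': "D' i = D i"
      using True by (auto simp: C'_def D'_def)
    have t: "C i a / s \<ge> 0"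
      using True s_nonneg by (simp add: P_def)
    have C'_a: "C' i a = 0"
      using s_zero(2)[OF _ True] by (auto simp: C' g_a)
    have ge: "C i \<alpha> \<le> C' i \<alpha>" if "\<alpha> \<noteq> a" for \<alpha>
      using mult_nonneg_nonneg[OF t g_nonneg[OF that]] by (simp add: C')
    have neg: "C i \<alpha> < 0" if "C' i \<alpha> < 0" for \<alpha>
    proof -
      have "\<alpha> \<noteq> a"
        using that C'_a by auto
      from ge[OF this] that show ?thesis by linarith
    qed
    have supp: "coeffs_in (A - {a}) B (C' i) (D' i)"
    proof -
      have "coeffs_in A B (C i) (D i)"
        using nn[OF \<open>i < m\<close>] by (simp add: nonneg_AG_def)
      moreover have "C' i \<alpha> = 0" if "\<alpha> \<notin> A" for \<alpha>
      proof -
        have "C i \<alpha> = 0" "g \<alpha> = 0"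
          using that g_supp[of \<alpha>] calculation unfolding coeffs_in_def by blast+
        then show ?thesis by (simp add: C')
      qed
      ultimately show ?thesis
        unfolding coeffs_in_def D' using C'_a by blast
    qed
    have ag: "even_AG (C' i) (D' i) \<or> odd_AG (C' i) (D' i)"
    proof -
      have "even_AG (C' i) (D' i)" if "even_AG (C i) (D i)"
        using that neg unfolding even_AG_def Uniq_def D' by blast
      moreover have "odd_AG (C' i) (D' i)" if "odd_AG (C i) (D i)"
        using that neg unfolding odd_AG_def D' by (meson not_less)
      ultimately show ?thesis
        using nn[OF \<open>i < m\<close>] unfolding nonneg_AG_def by blast
    qed
    have "0 \<le> ag_sum A B (C' i) (D' i) x" if "x \<in> nonzero_coords" for x
    proof -
      have "ag_sum A B (C' i) (D' i) x
          = ag_sum A B (C i) (D i) x + C i a / s * ag_sum A B g (\<lambda>\<beta>. 0) x"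
        using ag_sum_add_scaled[of A B "C i" "C i a / s" g "D i" "\<lambda>\<beta>. 0" x] by (simp add: C' D')
      also have "\<dots> \<ge> 0"
        using nn[OF \<open>i < m\<close>] g_sum[OF that] t that
        unfolding nonneg_AG_iff_nonzero_coords[OF assms(1,2)] by (intro add_nonneg_nonneg mult_nonneg_nonneg) auto
      finally show ?thesis .
    qed
    moreover have "coeffs_in A B (C' i) (D' i)"
      using supp by (auto simp: coeffs_in_def)
    ultimately show ?thesis
      using supp ag by (simp add: nonneg_AG_def ag_fun_nonneg_iff_nonzero_coords[OF assms(1,2)])
  qed
  moreover have "c = (\<lambda>\<alpha>. \<Sum>i<m. C' i \<alpha>)"
  proof
    fix \<alpha>
    have "(\<Sum>i<m. C' i \<alpha>) = (\<Sum>i\<in>P. C i \<alpha> + C i a / s * g \<alpha>)"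
      unfolding split using disj by (auto simp: C'_def intro!: sum.neutral)
    also have "\<dots> = (\<Sum>i\<in>P. C i \<alpha>) + s / s * g \<alpha>"
      by (simp only: sum.distrib sum_distrib_right[symmetric] sum_divide_distrib[symmetric]
          s_def[symmetric])
    also have "s / s * g \<alpha> = g \<alpha>"
      using s_zero(1) by (cases "s = 0") (auto simp: g_def)
    finally show "c \<alpha> = (\<Sum>i<m. C' i \<alpha>)"
      unfolding c split by (simp add: g_def)
  qed
  moreover have "d = (\<lambda>\<beta>. \<Sum>i<m. D' i \<beta>)"
    unfolding d using N(1) un by (intro ext sum.cong) (auto simp: D'_def)
  ultimately show ?thesis
    by (rule AG_decomposableI[where C = C' and D = D' and m = m])
qed

lemma AG_decomposable_restrict_even:
  assumes "finite R" "finite A" "finite B" and "AG_decomposable A B c d"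
    and "\<And>\<alpha>. \<alpha> \<in> R \<Longrightarrow> c \<alpha> = 0"
  shows "AG_decomposable (A - R) B c d"
  using assms
proof (induction R rule: finite_induct)
  case empty
  then show ?case by simp
next
  case (insert a R)
  then have "AG_decomposable (A - R - {a}) B c d"
    by (intro AG_decomposable_remove_even) auto
  then show ?case
    by (metis Diff_insert)
qed

section \<open>Sparsity of the S-cone\<close>

theorem proposition2p7:
  fixes A A' :: "(real ^ 'n) set" and B B' :: "(nat ^ 'n) set"
  assumes "finite A" and "A \<noteq> {}" and "finite B" and "B \<inter> even_exponents = {}"
    and "finite A'" and "A \<subseteq> A'"
    and "finite B'" and "B \<subseteq> B'" and "B' \<inter> even_exponents = {}"
  shows "(\<forall>f \<in> ag_space A B. f \<in> S_cone A' B' \<longrightarrow> f \<in> S_cone A B)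
         \<and> S_cone A B = S_cone A' B' \<inter> ag_space A B"
proof -
  have sparse: "f \<in> S_cone A B" if "f \<in> ag_space A B" "f \<in> S_cone A' B'" for f
  proof -
    from that(1) obtain c d where f: "f = ag_fun c d" and supp: "coeffs_in A B c d"
      by (auto simp: ag_space_def)
    from that(2) obtain c' d' where dec: "AG_decomposable A' B' c' d'" and f': "f = ag_fun c' d'"
      using S_cone_iff_AG_decomposable[OF \<open>finite A'\<close> \<open>finite B'\<close>] by blast
    have "coeffs_in A' B' c d"
      using supp \<open>A \<subseteq> A'\<close> \<open>B \<subseteq> B'\<close> by (auto simp: coeffs_in_def)
    then have "c = c'" "d = d'"
      using ag_fun_coeffs_unique[OF \<open>finite A'\<close> \<open>finite B'\<close> \<open>B' \<inter> even_exponents = {}\<close>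
          _ AG_decomposable_coeffs_in[OF dec]] f f' by auto
    with dec have "AG_decomposable A' B c d"
      using supp by (intro AG_decomposable_restrict_odd[OF \<open>finite A'\<close> \<open>finite B'\<close> \<open>B \<subseteq> B'\<close>])
        (auto simp: coeffs_in_def)
    then have "AG_decomposable (A' - (A' - A)) B c d"
      using supp \<open>finite A'\<close> \<open>finite B\<close>
      by (intro AG_decomposable_restrict_even) (auto simp: coeffs_in_def)
    moreover have "A' - (A' - A) = A"
      using \<open>A \<subseteq> A'\<close> by auto
    ultimately show ?thesis
      using f S_cone_iff_AG_decomposable[OF \<open>finite A\<close> \<open>finite B\<close>] by auto
  qed
  have "f \<in> S_cone A' B' \<inter> ag_space A B" if f: "f \<in> S_cone A B" for f
  proof -
    from f obtain c d where dec: "AG_decomposable A B c d" and c_d: "f = ag_fun c d"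
      using S_cone_iff_AG_decomposable[OF \<open>finite A\<close> \<open>finite B\<close>] by blast
    have "f \<in> S_cone A' B'"
      unfolding S_cone_iff_AG_decomposable[OF \<open>finite A'\<close> \<open>finite B'\<close>]
      using AG_decomposable_mono[OF dec \<open>A \<subseteq> A'\<close> \<open>B \<subseteq> B'\<close>] c_d by (intro exI conjI)
    moreover have "f \<in> ag_space A B"
      unfolding ag_space_def mem_Collect_eq
      using c_d AG_decomposable_coeffs_in[OF dec] by (intro exI conjI)
    ultimately show ?thesis by simp
  qed
  with sparse show ?thesis by blast
qed

end
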